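(* Let $L>0$, let $f:\mathbb{R}^n\to\mathbb{R}$ be a convex $L$-smooth function with a minimizer $x_\star$, let $k\ge 0$ be an integer and let $N=2^k-1$. For any $x_0\in\mathbb{R}^n$, let $x_1,\dots,x_N$ be generated by gradient descent $x_{i+1}=x_i-\frac{h_i}{L}\nabla f(x_i)$, $i=0,\dots,N-1$, with stepsizes $h=(h_0,\dots,h_{N-1})=\mathfrak{h}^{(k)}_{\mathrm{right}}$. Then $$f(x_N)-f(x_\star)\le \frac{\frac L2\|x_0-x_\star\|^2}{r_k}\simeq \frac{1}{(\varrho-1)(1+\varrho^{-1/2})}\cdot\frac{\frac L2\|x_0-x_\star\|^2}{N^{\log_2\varrho}},$$ where $\simeq$ denotes equality up to lower-order terms as $k\to\infty$, i.e. with $N=2^k-1$, $\lim_{k\to\infty} r_k/N^{\log_2\varrho}=(\varrho-1)(1+\varrho^{-1/2})$.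
   Context: $L$-smooth means differentiable with $L$-Lipschitz gradient (Euclidean norm). Let $\varrho=1+\sqrt2$ and $\beta_k=1+\varrho^{k-1}$ for $k\ge0$. All finite sequences are indexed starting from $0$, and $[\cdot,\cdot,\cdot]$ denotes concatenation. The silver stepsize schedules $\pi^{(k)}\in\mathbb{R}^{2^k-1}$, $k\ge1$, are defined by $\pi^{(1)}=[\sqrt2]$ and $\pi^{(k+1)}=[\pi^{(k)},\beta_k,\pi^{(k)}]$. The sequences $\mathfrak{h}^{(k)}_{\mathrm{right}}\in\mathbb{R}^{2^k-1}$, $k\ge1$, are defined by $\mathfrak{h}^{(1)}_{\mathrm{right}}=[3/2]$ and $\mathfrak{h}^{(k+1)}_{\mathrm{right}}=[\pi^{(k)},\alpha_k,\mathfrak{h}^{(k)}_{\mathrm{right}}]$, where $\alpha_k$ is the unique real number with $\alpha_k\ge1$ such that $$1+2\sum_{i=0}^{2^{k+1}-2}(\mathfrak{h}^{(k+1)}_{\mathrm{right}})_i=\prod_{i=0}^{2^{k+1}-2}\big((\mathfrak{h}^{(k+1)}_{\mathrm{right}})_i-1\big)^{-2}.$$ Define $r_k=1+2\sum_{i=0}^{2^k-2}(\mathfrak{h}^{(k)}_{\mathrm{right}})_i=\prod_{i=0}^{2^k-2}\big((\mathfrak{h}^{(k)}_{\mathrm{right}})_i-1\big)^{-2}$ (for instance $r_1=4$). For $k=0$ the sequence $\mathfrak{h}^{(0)}_{\mathrm{right}}$ is empty and $r_0=1$. *)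

theory Defs
  imports "HOL-Analysis.Analysis"
begin

definition grad :: "('a::euclidean_space \<Rightarrow> real) \<Rightarrow> 'a \<Rightarrow> 'a" where
  "grad f x = (THE D. GDERIV f x :> D)"

definition L_smooth :: "real \<Rightarrow> ('a::euclidean_space \<Rightarrow> real) \<Rightarrow> bool" where
  "L_smooth L f \<longleftrightarrow> (\<forall>x. f differentiable (at x)) \<and> L-lipschitz_on UNIV (grad f)"

lemma grad_eqI:
  assumes "GDERIV f x :> D"
  shows "grad f x = D"
  unfolding grad_def
proof (rule the_equality)
  show "GDERIV f x :> D" by fact
next
  fix E assume "GDERIV f x :> E"
  with assms have "(\<lambda>h. h \<bullet> D) = (\<lambda>h. h \<bullet> E)"
    unfolding gderiv_def by (intro has_derivative_unique)
  then show "E = D"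
    by (metis inner_commute vector_eq_ldot)
qed

lemma differentiable_GDERIV_grad:
  assumes "f differentiable (at x)"
  shows "GDERIV f x :> grad f x"
proof -
  obtain f' where f': "(f has_derivative f') (at x)"
    using assms unfolding differentiable_def by blast
  then have "linear f'"
    by (rule has_derivative_linear)
  then have "f' = (\<lambda>h. h \<bullet> adjoint f' 1)"
    using adjoint_works[of f' _ 1] by auto
  with f' have "GDERIV f x :> adjoint f' 1"
    unfolding gderiv_def by simp
  then show ?thesis
    using grad_eqI by metis
qed

definition silver_ratio :: real where
  "silver_ratio = 1 + sqrt 2"

definition silver_beta :: "nat \<Rightarrow> real" where
  "silver_beta k = 1 + silver_ratio powi (int k - 1)"

text \<open>
  Both schedules below are indexed by \<open>k \<ge> 1\<close> in the literature; the value at \<open>0\<close>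
  is the empty sequence.
\<close>

fun silver :: "nat \<Rightarrow> real list" where
  "silver 0 = []"
| "silver (Suc 0) = [sqrt 2]"
| "silver (Suc (Suc k)) = silver (Suc k) @ [silver_beta (Suc k)] @ silver (Suc k)"

definition balanced :: "real list \<Rightarrow> bool" where
  "balanced hs \<longleftrightarrow>
     1 + 2 * sum_list hs = prod_list (map (\<lambda>h. (h - 1) powi (-2)) hs)"

text \<open>
  An entry equal to \<open>1\<close> makes the right-hand side of \<^const>\<open>balanced\<close> zero, since
  \<open>0 powi (-2) = 0\<close>; the left-hand side is positive for the sequences considered, so
  the value \<open>a = 1\<close> is never selected below. Existence and uniqueness of the selected value
  are proved in \<open>silver_alpha_wellposed\<close>.
\<close>

definition balancing_step :: "real list \<Rightarrow> real list \<Rightarrow> real" where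
  "balancing_step xs ys = (THE a. a \<ge> 1 \<and> balanced (xs @ [a] @ ys))"

fun h_right :: "nat \<Rightarrow> real list" where
  "h_right 0 = []"
| "h_right (Suc 0) = [3 / 2]"
| "h_right (Suc (Suc k)) =
     silver (Suc k) @ [balancing_step (silver (Suc k)) (h_right (Suc k))] @ h_right (Suc k)"

definition r_right :: "nat \<Rightarrow> real" where
  "r_right k = 1 + 2 * sum_list (h_right k)"

lemma length_silver: "length (silver k) = 2 ^ k - 1"
  by (induction k rule: silver.induct) auto

lemma length_h_right: "length (h_right k) = 2 ^ k - 1"
  by (induction k rule: h_right.induct) (auto simp: length_silver)

lemma silver_gt_1: "h \<in> set (silver k) \<Longrightarrow> h > 1"
proof (induction k rule: silver.induct)
  case (3 k)
  have "silver_ratio > 0"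
    by (simp add: silver_ratio_def add_pos_nonneg)
  then have "silver_beta (Suc k) > 1"
    by (simp add: silver_beta_def)
  with 3 show ?case by auto
qed auto

lemma balancing_step_unique:
  assumes xs: "\<And>h. h \<in> set xs \<Longrightarrow> h > 1" and ys: "\<And>h. h \<in> set ys \<Longrightarrow> h > 1"
  shows "\<exists>!a. a \<ge> 1 \<and> balanced (xs @ [a] @ ys)"
    and "a \<ge> 1 \<Longrightarrow> balanced (xs @ [a] @ ys) \<Longrightarrow> a > 1"
proof -
  define P where "P zs = prod_list (map (\<lambda>h. (h - 1) powi (-2)) zs)" for zs :: "real list"
  define B where "B = 1 + 2 * (sum_list xs + sum_list ys)"
  define C where "C = P xs * P ys"
  define g where "g a = (B + 2 * a) * (a - 1)\<^sup>2" for a :: real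
  have P_pos: "P zs > 0" if "\<And>h. h \<in> set zs \<Longrightarrow> h > 1" for zs
    using that unfolding P_def by (induction zs) (auto intro!: mult_pos_pos)
  have C: "C > 0"
    unfolding C_def using P_pos[of xs] P_pos[of ys] xs ys by simp
  have "sum_list xs \<ge> 0" "sum_list ys \<ge> 0"
    using xs ys by (force intro: sum_list_nonneg)+
  then have B: "B \<ge> 1"
    by (simp add: B_def)
  have bal: "balanced (xs @ [a] @ ys) \<longleftrightarrow> B + 2 * a = C * (a - 1) powi (-2)" for a
    by (simp add: balanced_def B_def C_def P_def algebra_simps)
  have not1: "\<not> balanced (xs @ [1] @ ys)"
    unfolding bal using B by simp
  have bal_iff: "balanced (xs @ [a] @ ys) \<longleftrightarrow> g a = C" if "a > 1" for a
    unfolding bal g_def using that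
    by (simp add: power_int_minus field_simps)
  have g_mono: "g a < g b" if "1 < a" "a < b" for a b
    unfolding g_def using that B
    by (intro mult_strict_mono power_strict_mono) auto
  have "\<exists>a\<ge>1. a \<le> 2 + C \<and> g a = C"
  proof (rule IVT')
    show "g 1 \<le> C" using C by (simp add: g_def)
    have "C * 1 \<le> (B + 2 * (2 + C)) * (2 + C - 1)\<^sup>2"
      using B C by (intro mult_mono one_le_power) auto
    then show "C \<le> g (2 + C)" by (simp add: g_def)
    show "1 \<le> 2 + C" using C by simp
    show "continuous_on {1..2 + C} g"
      unfolding g_def by (intro continuous_intros)
  qed
  then obtain a where a: "a \<ge> 1" "g a = C" by blast
  have "a \<noteq> 1" using a C by (auto simp: g_def)
  with a have a1: "a > 1" by simp
  have gt: "b > 1" if "b \<ge> 1" "balanced (xs @ [b] @ ys)" for b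
    using that not1 by (cases "b = 1") auto
  show "\<exists>!a. a \<ge> 1 \<and> balanced (xs @ [a] @ ys)"
  proof (rule ex1I[of _ a])
    show "a \<ge> 1 \<and> balanced (xs @ [a] @ ys)"
      using a a1 bal_iff by auto
    fix b assume b: "b \<ge> 1 \<and> balanced (xs @ [b] @ ys)"
    then have "b > 1" using gt by blast
    with b have "g b = g a" using bal_iff a by auto
    with a1 \<open>b > 1\<close> g_mono show "b = a"
      by (metis less_irrefl linorder_neqE)
  qed
  show "a \<ge> 1 \<Longrightarrow> balanced (xs @ [a] @ ys) \<Longrightarrow> a > 1" for a
    by (rule gt)
qed

lemma h_right_gt_1: "h \<in> set (h_right k) \<Longrightarrow> h > 1"
proof (induction k arbitrary: h rule: h_right.induct)
  case (3 k)
  let ?xs = "silver (Suc k)" and ?ys = "h_right (Suc k)"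
  have ex: "\<exists>!a. a \<ge> 1 \<and> balanced (?xs @ [a] @ ?ys)"
    using balancing_step_unique(1) silver_gt_1 3 by blast
  have "balancing_step ?xs ?ys \<ge> 1 \<and> balanced (?xs @ [balancing_step ?xs ?ys] @ ?ys)"
    unfolding balancing_step_def by (rule theI'[OF ex])
  then have "balancing_step ?xs ?ys > 1"
    using balancing_step_unique(2)[of ?xs ?ys] silver_gt_1 3 by blast
  with 3 show ?case using silver_gt_1 by auto
qed auto

lemma silver_alpha_wellposed:
  "\<exists>!a. a \<ge> 1 \<and> balanced (silver (Suc k) @ [a] @ h_right (Suc k))"
  using balancing_step_unique(1) silver_gt_1 h_right_gt_1 by blast

lemma balanced_h_right: "balanced (h_right k)"
proof (cases k rule: h_right.cases)
  case (3 j)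
  show ?thesis
    using theI'[OF silver_alpha_wellposed[of j]] unfolding 3 by (simp add: balancing_step_def)
qed (auto simp: balanced_def power_int_minus power2_eq_square)

lemma r_right_eq_prod:
  "r_right k = prod_list (map (\<lambda>h. (h - 1) powi (-2)) (h_right k))"
  using balanced_h_right[of k] by (simp add: r_right_def balanced_def)

end

theory Submission
  imports Defs
begin

text \<open>
  After dividing by \<open>L\<close>, the objective is a convex \<open>1\<close>-smooth function \<open>F\<close> with gradient
  \<open>G\<close>, hence the Moreau envelope of a convex function \<open>\<phi>\<close>: with \<open>p x = x - G x\<close>, the vector
  \<open>G x\<close> is a subgradient of \<open>\<phi>\<close> at \<open>p x\<close>, and \<open>\<phi> (p x) = F x - \<bar>G x\<bar>\<^sup>2 / 2\<close>.
  For a schedule that leads from \<open>x\<close> to \<open>y\<close> there are two kinds of guarantee: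

  \<^item> a value rate \<open>R\<close>: \<open>2 R (F y - c) \<le> \<bar>x - z\<bar>\<^sup>2\<close>;
  \<^item> a prox rate \<open>a\<close>:
    \<open>2 a (\<phi> (p y) - c) + a\<^sup>2 \<bar>G y\<bar>\<^sup>2 + \<bar>p y - z\<bar>\<^sup>2 \<le> \<bar>x - z\<bar>\<^sup>2\<close>.

  Both are demanded for every point \<open>(z, c)\<close> of the epigraph of \<open>\<phi>\<close>, not merely for a
  minimizer and the minimal value. This generality is what lets guarantees for two consecutive
  pieces of a schedule be combined: the guarantee of the second piece may be used with a
  reference point that depends on the run itself, such as the point \<open>p m\<close> of the iterate \<open>m\<close>
  at which the pieces meet, the point \<open>p n\<close> of the last iterate \<open>n\<close>, or a convex combination of
  these with \<open>(z, c)\<close>.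

  Two joining lemmas carry the proof. Both concern a schedule \<open>hs @ [1 + a t] @ hs'\<close>, where \<open>hs\<close>
  has prox rate \<open>a\<close> and \<open>0 < t < 1\<close>. Lemma \<open>prox_rate_join\<close> gives it a prox rate if \<open>hs'\<close> has
  a suitable one; with \<open>t = 1 / \<rho>\<close>, where \<open>\<rho>\<close> is the silver ratio, induction gives prox rate
  \<open>\<rho>\<^sup>k\<close> for the \<open>k\<close>-th silver schedule. Lemma \<open>value_rate_join\<close> does the same for value rates. The
  balancing equation that defines the middle step of the right-sided schedule says precisely
  that its parameter \<open>t\<close> meets the hypothesis of \<open>value_rate_join\<close> with \<open>R = r\<^sub>k\<^sub>+\<^sub>1\<close>, so
  induction gives the value rate \<open>r\<^sub>k\<close>. A minimizer with its value lies in the epigraph, and the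
  bound follows.

  For the asymptotics, let \<open>t\<^sub>k\<close> be the parameter of the step that joins the \<open>k\<close>-th schedules.
  Then \<open>r\<^sub>k\<^sub>+\<^sub>1 = 2 \<rho>\<^sup>k / (1 - t\<^sub>k)\<close> and \<open>r\<^sub>k = r\<^sub>k\<^sub>+\<^sub>1 t\<^sub>k\<^sup>2\<close>. Eliminating \<open>r\<close> leaves a one-dimensional
  recursion for \<open>t\<^sub>k\<close> with fixed point \<open>\<rho>\<^sup>-\<^sup>1\<^sup>/\<^sup>2\<close>, to which \<open>t\<^sub>k\<close> converges geometrically.
\<close>

section \<open>Convex functions with Lipschitz gradient\<close>

lemma gradient_has_real_derivative_line:
  fixes f :: "'a::real_inner \<Rightarrow> real"
  assumes "\<And>x. GDERIV f x :> G x"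
  shows "((\<lambda>t. f (x + t *\<^sub>R v)) has_real_derivative G (x + t *\<^sub>R v) \<bullet> v) (at t)"
proof -
  have "((\<lambda>t. f (x + t *\<^sub>R v)) has_derivative (\<lambda>h. (h *\<^sub>R v) \<bullet> G (x + t *\<^sub>R v))) (at t)"
  proof (rule has_derivative_compose[of "\<lambda>t. x + t *\<^sub>R v" "\<lambda>h. h *\<^sub>R v" t UNIV f])
    show "((\<lambda>t. x + t *\<^sub>R v) has_derivative (\<lambda>h. h *\<^sub>R v)) (at t)"
      by (auto intro!: derivative_eq_intros)
    show "(f has_derivative (\<lambda>y. y \<bullet> G (x + t *\<^sub>R v))) (at (x + t *\<^sub>R v))"
      using assms unfolding gderiv_def by blast
  qed
  then show ?thesis
    by (simp add: has_field_derivative_def inner_commute mult_commute_abs)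
qed

lemma convex_above_tangent_plane:
  fixes f :: "'a::real_inner \<Rightarrow> real"
  assumes conv: "convex_on UNIV f" and G: "\<And>x. GDERIV f x :> G x"
  shows "f x + G x \<bullet> (y - x) \<le> f y"
proof -
  define \<phi> where "\<phi> t = f (x + t *\<^sub>R (y - x))" for t
  have "convex_on UNIV \<phi>"
  proof (rule convex_onI)
    fix t a b :: real assume t: "0 < t" "t < 1"
    have eq: "x + ((1 - t) *\<^sub>R a + t *\<^sub>R b) *\<^sub>R (y - x)
        = (1 - t) *\<^sub>R (x + a *\<^sub>R (y - x)) + t *\<^sub>R (x + b *\<^sub>R (y - x))"
      by (simp add: algebra_simps)
    show "\<phi> ((1 - t) *\<^sub>R a + t *\<^sub>R b) \<le> (1 - t) * \<phi> a + t * \<phi> b"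
      unfolding \<phi>_def eq by (rule convex_onD[OF conv]) (use t in auto)
  qed auto
  moreover have "(\<phi> has_real_derivative G x \<bullet> (y - x)) (at 0)"
    using gradient_has_real_derivative_line[OF G, of x "y - x" 0] by (simp add: \<phi>_def[abs_def])
  ultimately have "\<phi> 1 - \<phi> 0 \<ge> (G x \<bullet> (y - x)) * (1 - 0)"
    by (intro convex_on_imp_above_tangent) auto
  then show ?thesis by (simp add: \<phi>_def)
qed

text \<open>The derivative of \<open>t \<mapsto> f (x + t v)\<close> exceeds its value at \<open>0\<close> by at most
  \<open>L t \<bar>v\<bar>\<^sup>2\<close>, so subtracting \<open>L t\<^sup>2 \<bar>v\<bar>\<^sup>2 / 2\<close> and the linear part leaves a
  nonincreasing function.\<close>

lemma lipschitz_gradient_upper_bound: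
  fixes f :: "'a::real_inner \<Rightarrow> real"
  assumes lip: "L-lipschitz_on UNIV G" and G: "\<And>x. GDERIV f x :> G x"
  shows "f (x + v) \<le> f x + G x \<bullet> v + L / 2 * (norm v)\<^sup>2"
proof -
  define \<psi> where "\<psi> t = f (x + t *\<^sub>R v) - t * (G x \<bullet> v) - L / 2 * t\<^sup>2 * (norm v)\<^sup>2" for t
  have "\<psi> 1 \<le> \<psi> 0"
  proof (rule DERIV_nonpos_imp_nonincreasing[of 0 1 \<psi>])
    fix t :: real assume t: "0 \<le> t" "t \<le> 1"
    have "(\<psi> has_real_derivative G (x + t *\<^sub>R v) \<bullet> v - G x \<bullet> v - L * t * (norm v)\<^sup>2) (at t)"
      unfolding \<psi>_def
      by (auto intro!: derivative_eq_intros gradient_has_real_derivative_line[OF G])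
    moreover have "G (x + t *\<^sub>R v) \<bullet> v - G x \<bullet> v - L * t * (norm v)\<^sup>2 \<le> 0"
    proof -
      have "(G (x + t *\<^sub>R v) - G x) \<bullet> v \<le> norm (G (x + t *\<^sub>R v) - G x) * norm v"
        by (rule norm_cauchy_schwarz)
      also have "\<dots> \<le> (L * (t * norm v)) * norm v"
        using lipschitz_onD[OF lip, of "x + t *\<^sub>R v" x] t
        by (intro mult_right_mono) (auto simp: dist_norm)
      finally show ?thesis by (simp add: inner_diff_left power2_eq_square)
    qed
    ultimately show "\<exists>d. (\<psi> has_real_derivative d) (at t) \<and> d \<le> 0" by blast
  qed simp
  then show ?thesis by (simp add: \<psi>_def)
qed

text \<open>A gradient step of length \<open>1 / L\<close> from \<open>y\<close> on \<open>f - G x \<bullet> _\<close>, which is minimized at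
  \<open>x\<close>, decreases that function by at least \<open>\<bar>G y - G x\<bar>\<^sup>2 / (2 L)\<close>.\<close>

lemma convex_smooth_cocoercive:
  fixes f :: "'a::real_inner \<Rightarrow> real"
  assumes L: "L > 0" and conv: "convex_on UNIV f"
    and lip: "L-lipschitz_on UNIV G" and G: "\<And>x. GDERIV f x :> G x"
  shows "f x + G x \<bullet> (y - x) + (norm (G x - G y))\<^sup>2 / (2 * L) \<le> f y"
proof -
  define d where "d = G y - G x"
  define v where "v = - (1 / L) *\<^sub>R d"
  have "f x + G x \<bullet> (y + v - x) \<le> f (y + v)"
    by (rule convex_above_tangent_plane[OF conv G])
  also have "\<dots> \<le> f y + G y \<bullet> v + L / 2 * (norm v)\<^sup>2"
    by (rule lipschitz_gradient_upper_bound[OF lip G])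
  finally have "f x + G x \<bullet> (y - x) \<le> f y + d \<bullet> v + L / 2 * (norm v)\<^sup>2"
    by (simp add: d_def inner_simps)
  moreover have "d \<bullet> v = - (norm d)\<^sup>2 / L"
    by (simp add: v_def power2_norm_eq_inner)
  moreover have "L / 2 * (norm v)\<^sup>2 = (norm d)\<^sup>2 / (2 * L)"
    using L by (simp add: v_def power_mult_distrib power2_eq_square)
  moreover have "norm (G x - G y) = norm d"
    by (simp add: d_def norm_minus_commute)
  moreover have "(norm d)\<^sup>2 / (2 * L) - (norm d)\<^sup>2 / L = - ((norm d)\<^sup>2 / (2 * L))"
    using L by (simp add: field_simps)
  ultimately show ?thesis by simp
qed

section \<open>Gradient descent and the convex function behind a Moreau envelope\<close>

locale cocoercive_gradient =
  fixes F :: "'a::real_inner \<Rightarrow> real" and G :: "'a \<Rightarrow> 'a"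
  assumes cocoercive: "F x + G x \<bullet> (y - x) + (norm (G x - G y))\<^sup>2 / 2 \<le> F y"
begin

definition prox :: "'a \<Rightarrow> 'a" where
  "prox x = x - G x"

text \<open>The value at \<^term>\<open>prox x\<close> of the convex function \<open>\<phi>\<close> whose Moreau envelope is \<open>F\<close>.\<close>

definition prox_value :: "'a \<Rightarrow> real" where
  "prox_value x = F x - (norm (G x))\<^sup>2 / 2"

text \<open>The supremum of these affine functions of \<open>z\<close> is \<open>\<phi>\<close>. It may be infinite at some
  points, so its epigraph is used in place of its values.\<close>

definition in_epigraph :: "'a \<Rightarrow> real \<Rightarrow> bool" where
  "in_epigraph z c \<longleftrightarrow> (\<forall>x. prox_value x + G x \<bullet> (z - prox x) \<le> c)"

definition descend :: "real list \<Rightarrow> 'a \<Rightarrow> 'a" where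
  "descend hs x = foldl (\<lambda>y h. y - h *\<^sub>R G y) x hs"

definition value_rate :: "real list \<Rightarrow> real \<Rightarrow> bool" where
  "value_rate hs R \<longleftrightarrow> (\<forall>x z c. in_epigraph z c \<longrightarrow>
     2 * R * (F (descend hs x) - c) \<le> (norm (x - z))\<^sup>2)"

text \<open>This inequality is tight both for the quadratic \<open>\<bar>x\<bar>\<^sup>2 / 2\<close>, if the product of \<open>\<bar>h - 1\<bar>\<close> over the
  schedule is \<open>1 / a\<close>, and for suitable Huber functions, if \<open>a\<close> is one plus the sum of the steps. The
  square \<open>\<bar>prox y - z\<bar>\<^sup>2\<close> on the left carries the information about the position of the
  end point \<open>y\<close> that the joining lemmas consume.\<close>

definition prox_rate :: "real list \<Rightarrow> real \<Rightarrow> bool" where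
  "prox_rate hs a \<longleftrightarrow> (\<forall>x z c. in_epigraph z c \<longrightarrow>
     2 * a * (prox_value (descend hs x) - c) + a\<^sup>2 * (norm (G (descend hs x)))\<^sup>2
       + (norm (prox (descend hs x) - z))\<^sup>2 \<le> (norm (x - z))\<^sup>2)"

lemma in_epigraphD: "in_epigraph z c \<Longrightarrow> prox_value x + G x \<bullet> (z - prox x) \<le> c"
  by (simp add: in_epigraph_def)

text \<open>Written in terms of \<^const>\<open>prox\<close> and \<^const>\<open>prox_value\<close>, cocoercivity is the
  subgradient inequality of \<open>\<phi>\<close> between two prox points.\<close>

lemma in_epigraph_prox: "in_epigraph (prox x) (prox_value x)"
  unfolding in_epigraph_def
proof
  fix y
  show "prox_value y + G y \<bullet> (prox x - prox y) \<le> prox_value x"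
    using cocoercive[of y x]
    by (simp add: prox_def prox_value_def power2_norm_eq_inner inner_simps inner_commute field_simps)
qed

lemma in_epigraph_convex:
  assumes "in_epigraph z c" "in_epigraph z' c'" "0 \<le> t" "t \<le> 1"
  shows "in_epigraph (t *\<^sub>R z + (1 - t) *\<^sub>R z') (t * c + (1 - t) * c')"
  unfolding in_epigraph_def
proof
  fix x
  have "t * (prox_value x + G x \<bullet> (z - prox x)) \<le> t * c"
    "(1 - t) * (prox_value x + G x \<bullet> (z' - prox x)) \<le> (1 - t) * c'"
    using assms by (auto intro!: mult_left_mono in_epigraphD)
  then show "prox_value x + G x \<bullet> (t *\<^sub>R z + (1 - t) *\<^sub>R z' - prox x) \<le> t * c + (1 - t) * c'"
    by (simp add: inner_simps algebra_simps)
qed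

lemma in_epigraph_minimizer:
  assumes "\<And>y. F z \<le> F y" and "G z = 0"
  shows "in_epigraph z (F z)"
  using in_epigraph_prox[of z] assms by (simp add: prox_def prox_value_def)

lemma descend_join: "descend (hs @ [h] @ hs') x
    = descend hs' (descend hs x - h *\<^sub>R G (descend hs x))"
  by (simp add: descend_def)

lemma descend_eq_iterate:
  assumes "\<And>i. i < length hs \<Longrightarrow> x (Suc i) = x i - (hs ! i) *\<^sub>R G (x i)"
  shows "descend hs (x 0) = x (length hs)"
proof -
  have "i \<le> length hs \<Longrightarrow> descend (take i hs) (x 0) = x i" for i
    by (induction i) (auto simp: descend_def take_Suc_conv_app_nth assms)
  from this[of "length hs"] show ?thesis by simp
qed

lemma prox_rate_Nil: "prox_rate [] 1"
  unfolding prox_rate_def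
proof (intro allI impI)
  fix x z c assume "in_epigraph z c"
  from in_epigraphD[OF this, of x]
  show "2 * 1 * (prox_value (descend [] x) - c) + 1\<^sup>2 * (norm (G (descend [] x)))\<^sup>2
       + (norm (prox (descend [] x) - z))\<^sup>2 \<le> (norm (x - z))\<^sup>2"
    by (simp add: descend_def prox_def power2_norm_eq_inner inner_simps inner_commute algebra_simps)
qed

lemma value_rate_Nil: "value_rate [] 1"
  unfolding value_rate_def
proof (intro allI impI)
  fix x z c assume "in_epigraph z c"
  from in_epigraphD[OF this, of x] zero_le_power2[of "norm (x - z - G x)"]
  show "2 * 1 * (F (descend [] x) - c) \<le> (norm (x - z))\<^sup>2"
    unfolding power2_norm_eq_inner
    by (simp add: descend_def prox_def prox_value_def power2_norm_eq_inner inner_simps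
        inner_commute algebra_simps)
qed

text \<open>
  Let \<open>m\<close> be the iterate at which \<open>hs\<close> ends and \<open>n\<close> the last one. The guarantee of \<open>hs\<close> and that of
  \<open>hs'\<close>, both with reference point \<open>(z, c)\<close>, and the subgradient inequality from \<open>p m\<close> to \<open>z\<close> add
  up to the claim, up to a multiple of
  \<open>(1 + t) s\<^sup>2 \<bar>G n\<bar>\<^sup>2 + 2 s (\<phi> (p n) - \<phi> (p m)) \<le> (1 + t) a\<^sup>2 \<bar>G m\<bar>\<^sup>2\<close>, a statement about the decrease of the
  gradient from \<open>m\<close> to \<open>n\<close> that does not mention \<open>z\<close>. It follows from the guarantee of \<open>hs'\<close> with the two
  reference points \<open>p m\<close> and \<open>p n\<close>, with equal weights, and the subgradient inequality from \<open>p m\<close> to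
  \<open>p n\<close>.
\<close>

lemma prox_rate_join:
  assumes hs: "prox_rate hs a" and hs': "prox_rate hs' (t * s)"
    and a: "a > 0" and t: "0 < t" "t < 1" and s: "s * (1 - t) = a * (1 + t)"
  shows "prox_rate (hs @ [1 + a * t] @ hs') s"
  unfolding prox_rate_def
proof (intro allI impI)
  fix x z c assume z: "in_epigraph z c"
  define m where "m = descend hs x"
  define y where "y = prox m - (a * t) *\<^sub>R G m"
  define n where "n = descend hs' y"
  have end_point: "descend (hs @ [1 + a * t] @ hs') x = n"
    unfolding descend_join n_def y_def m_def prox_def by (simp add: algebra_simps)
  define E where "E = prox_value n - prox_value m"
  define v where "v = prox n - prox m"
  define gm where "gm = (norm (G m))\<^sup>2"
  define gn where "gn = (norm (G n))\<^sup>2"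
  define R where "R = (norm (x - z))\<^sup>2"

  (* The step of length 1 + a t leads to y, so the guarantee of hs' with reference p m bounds
     everything by |y - p m|^2, a multiple of |G m|^2. *)
  have ref_m: "2 * (t * s) * E + (t * s)\<^sup>2 * gn + (norm v)\<^sup>2 \<le> (a * t)\<^sup>2 * gm"
    using hs'[unfolded prox_rate_def, rule_format, OF in_epigraph_prox, of y m]
    unfolding n_def[symmetric] E_def v_def gm_def gn_def
    by (simp add: y_def power_mult_distrib)
  (* With the end point's own p n as reference, only the gradient term is left on the left. *)
  have "(t * s)\<^sup>2 * gn \<le> (norm (y - prox n))\<^sup>2"
    using hs'[unfolded prox_rate_def, rule_format, OF in_epigraph_prox, of y n]
    by (simp add: n_def[symmetric] gn_def)
  also have "y - prox n = - (v + (a * t) *\<^sub>R G m)"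
    by (simp add: y_def v_def)
  also have "(norm (- (v + (a * t) *\<^sub>R G m)))\<^sup>2
      = (norm v)\<^sup>2 + 2 * (a * t) * (G m \<bullet> v) + (a * t)\<^sup>2 * gm"
    unfolding norm_minus_cancel gm_def power2_norm_eq_inner
    by (simp add: inner_simps inner_commute power2_eq_square algebra_simps)
  finally have ref_n: "(t * s)\<^sup>2 * gn \<le> (norm v)\<^sup>2 + 2 * (a * t) * (G m \<bullet> v) + (a * t)\<^sup>2 * gm" .
  have "G m \<bullet> v \<le> E"
    using in_epigraphD[OF in_epigraph_prox[of n], of m] by (simp add: E_def v_def)
  then have "2 * (a * t) * (G m \<bullet> v) \<le> 2 * (a * t) * E"
    using a t by (intro mult_left_mono) auto
  with ref_m ref_n have "2 * (t * s)\<^sup>2 * gn + 2 * (t * s - a * t) * E \<le> 2 * (a * t)\<^sup>2 * gm"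
    by (simp add: algebra_simps)
  then have "(2 * t) * (t * s\<^sup>2 * gn + (s - a) * E) \<le> (2 * t) * (a\<^sup>2 * t * gm)"
    by (simp add: algebra_simps power2_eq_square)
  then have "t * s\<^sup>2 * gn + (s - a) * E \<le> a\<^sup>2 * t * gm"
    using t by (subst (asm) mult_le_cancel_left_pos) auto
  then have "(1 + t) * (t * s\<^sup>2 * gn + (s - a) * E) \<le> (1 + t) * (a\<^sup>2 * t * gm)"
    using t by (intro mult_left_mono) auto
  moreover have "(1 + t) * (s - a) = 2 * t * s"
    using s by (simp add: algebra_simps)
  then have "(1 + t) * ((s - a) * E) = 2 * t * s * E"
    by (simp add: mult.assoc[symmetric])
  ultimately have "t * ((1 + t) * s\<^sup>2 * gn + 2 * s * E) \<le> t * ((1 + t) * a\<^sup>2 * gm)"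
    by (simp add: algebra_simps)
  then have "(1 + t) * s\<^sup>2 * gn + 2 * s * E \<le> (1 + t) * a\<^sup>2 * gm"
    using t by (subst (asm) mult_le_cancel_left_pos) auto
  (* The factor 1 - t is the weight with which the decrease enters the final sum. *)
  then have decrease: "(1 - t) * ((1 + t) * s\<^sup>2 * gn + 2 * s * E) \<le> (1 - t) * ((1 + t) * a\<^sup>2 * gm)"
    using t by (intro mult_left_mono) auto

  have first: "2 * a * (prox_value m - c) + a\<^sup>2 * gm + (norm (prox m - z))\<^sup>2 \<le> R"
    using hs[unfolded prox_rate_def, rule_format, OF z, of x] by (simp add: m_def gm_def R_def)
  have "2 * (t * s) * (prox_value n - c) + (t * s)\<^sup>2 * gn + (norm (prox n - z))\<^sup>2
      \<le> (norm (y - z))\<^sup>2"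
    using hs'[unfolded prox_rate_def, rule_format, OF z, of y] by (simp add: n_def gn_def)
  also have "y - z = (prox m - z) - (a * t) *\<^sub>R G m"
    by (simp add: y_def)
  also have "(norm ((prox m - z) - (a * t) *\<^sub>R G m))\<^sup>2
      = (norm (prox m - z))\<^sup>2 + 2 * (a * t) * (G m \<bullet> (z - prox m)) + (a * t)\<^sup>2 * gm"
    unfolding gm_def power2_norm_eq_inner
    by (simp add: inner_simps inner_commute power2_eq_square algebra_simps)
  also have "2 * (a * t) * (G m \<bullet> (z - prox m)) \<le> 2 * (a * t) * (c - prox_value m)"
    using in_epigraphD[OF z, of m] a t by (intro mult_left_mono) auto
  finally have second: "2 * (t * s) * (prox_value n - c) + (t * s)\<^sup>2 * gn + (norm (prox n - z))\<^sup>2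
      \<le> (norm (prox m - z))\<^sup>2 + 2 * (a * t) * (c - prox_value m) + (a * t)\<^sup>2 * gm"
    by simp
  have "2 * (s * (1 - t)) * (prox_value m - c) = 2 * (a * (1 + t)) * (prox_value m - c)"
    by (simp only: s)
  with first second decrease
  show "2 * s * (prox_value (descend (hs @ [1 + a * t] @ hs') x) - c)
      + s\<^sup>2 * (norm (G (descend (hs @ [1 + a * t] @ hs') x)))\<^sup>2
      + (norm (prox (descend (hs @ [1 + a * t] @ hs') x) - z))\<^sup>2 \<le> (norm (x - z))\<^sup>2"
    unfolding end_point R_def[symmetric] gn_def[symmetric] E_def
    by (simp add: algebra_simps power2_eq_square)
qed

text \<open>
  The guarantee of \<open>hs'\<close> is used with the single reference point \<open>t (z, c) + (1 - t) (p m, \<phi> (p m))\<close>, where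
  \<open>m\<close> is the iterate at which \<open>hs\<close> ends. This weight makes the distance of the start of \<open>hs'\<close> to the
  reference point exactly \<open>t\<close> times \<open>\<bar>p m - z - a G m\<bar>\<close>. Expanding this square produces the two
  squares in the prox rate of \<open>hs\<close>, and the inner product is bounded by the subgradient
  inequality from \<open>p m\<close> to \<open>z\<close>.
\<close>

lemma value_rate_join:
  assumes hs: "prox_rate hs a" and hs': "value_rate hs' (R * t\<^sup>2)"
    and a: "a > 0" and t: "0 < t" "t < 1" and R: "R * (1 - t) = 2 * a"
  shows "value_rate (hs @ [1 + a * t] @ hs') R"
  unfolding value_rate_def
proof (intro allI impI)
  fix x z c assume z: "in_epigraph z c"
  define m where "m = descend hs x"
  define y where "y = prox m - (a * t) *\<^sub>R G m"
  define n where "n = descend hs' y"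
  have end_point: "descend (hs @ [1 + a * t] @ hs') x = n"
    unfolding descend_join n_def y_def m_def prox_def by (simp add: algebra_simps)
  define d where "d = prox_value m - c"
  have "2 * (R * t\<^sup>2) * (F n - (t * c + (1 - t) * prox_value m))
      \<le> (norm (y - (t *\<^sub>R z + (1 - t) *\<^sub>R prox m)))\<^sup>2"
    unfolding n_def using t
    by (intro hs'[unfolded value_rate_def, rule_format] in_epigraph_convex[OF z in_epigraph_prox]) auto
  also have "y - (t *\<^sub>R z + (1 - t) *\<^sub>R prox m) = t *\<^sub>R (prox m - z - a *\<^sub>R G m)"
    by (simp add: y_def algebra_simps)
  finally have "t\<^sup>2 * (2 * R * (F n - (t * c + (1 - t) * prox_value m)))
      \<le> t\<^sup>2 * (norm (prox m - z - a *\<^sub>R G m))\<^sup>2"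
    by (simp add: power_mult_distrib) (simp add: algebra_simps)
  then have "2 * R * (F n - (t * c + (1 - t) * prox_value m)) \<le> (norm (prox m - z - a *\<^sub>R G m))\<^sup>2"
    using t by (subst (asm) mult_le_cancel_left_pos) auto
  also have "(norm (prox m - z - a *\<^sub>R G m))\<^sup>2
      = (norm (prox m - z))\<^sup>2 + 2 * a * (G m \<bullet> (z - prox m)) + a\<^sup>2 * (norm (G m))\<^sup>2"
    unfolding power2_norm_eq_inner
    by (simp add: inner_simps inner_commute power2_eq_square algebra_simps)
  also have "2 * a * (G m \<bullet> (z - prox m)) \<le> 2 * a * (- d)"
    using in_epigraphD[OF z, of m] a by (intro mult_left_mono) (auto simp: d_def)
  finally have "2 * R * (F n - (t * c + (1 - t) * prox_value m))
      \<le> (norm (prox m - z))\<^sup>2 - 2 * a * d + a\<^sup>2 * (norm (G m))\<^sup>2"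
    by simp
  moreover have "2 * a * d + a\<^sup>2 * (norm (G m))\<^sup>2 + (norm (prox m - z))\<^sup>2 \<le> (norm (x - z))\<^sup>2"
    using hs[unfolded prox_rate_def, rule_format, OF z, of x] by (simp add: m_def d_def)
  moreover have "2 * R * (F n - (t * c + (1 - t) * prox_value m))
      = 2 * R * (F n - c) - 2 * (R * (1 - t)) * d"
    by (simp add: d_def algebra_simps)
  ultimately show "2 * R * (F (descend (hs @ [1 + a * t] @ hs') x) - c) \<le> (norm (x - z))\<^sup>2"
    unfolding end_point R by (simp add: algebra_simps)
qed

end


section \<open>The silver schedule\<close>

lemma silver_ratio_gt_1: "silver_ratio > 1"
  by (simp add: silver_ratio_def)

lemma silver_ratio_square: "silver_ratio\<^sup>2 = 2 * silver_ratio + 1"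
  by (simp add: silver_ratio_def power2_eq_square algebra_simps)

lemma inverse_silver_ratio: "1 / silver_ratio = silver_ratio - 2"
  using silver_ratio_square silver_ratio_gt_1 by (simp add: field_simps power2_eq_square)

text \<open>In this form the recursion starts at the empty schedule, and the middle step has the shape
  \<open>1 + a t\<close> of the joining lemmas, with \<open>a = \<rho>\<^sup>k\<close> and \<open>t = 1 / \<rho>\<close>.\<close>

lemma silver_Suc: "silver (Suc k) = silver k @ [1 + silver_ratio ^ k * (1 / silver_ratio)] @ silver k"
proof (cases k)
  case 0
  then show ?thesis unfolding inverse_silver_ratio by (simp add: silver_ratio_def)
next
  case (Suc j)
  have "silver_ratio ^ Suc j * (1 / silver_ratio) = silver_ratio ^ j"
    using silver_ratio_gt_1 by simp
  then show ?thesis using Suc by (simp add: silver_beta_def)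
qed

lemma sum_silver: "sum_list (silver k) = silver_ratio ^ k - 1"
proof (induction k)
  case (Suc k)
  have "silver_ratio ^ k * (1 / silver_ratio) = silver_ratio ^ Suc k - 2 * silver_ratio ^ k"
    unfolding inverse_silver_ratio by (simp add: algebra_simps)
  with Suc show ?case unfolding silver_Suc by simp
qed simp

lemma prod_silver:
  "prod_list (map (\<lambda>h. (h - 1) powi (-2)) (silver k)) = (silver_ratio ^ k)\<^sup>2"
proof (induction k)
  case (Suc k)
  have "((silver_ratio ^ k)\<^sup>2) * ((silver_ratio ^ k * (1 / silver_ratio)) powi (-2)
      * (silver_ratio ^ k)\<^sup>2) = (silver_ratio ^ Suc k)\<^sup>2"
    using silver_ratio_gt_1 by (simp add: power_int_minus field_simps)
  with Suc show ?case unfolding silver_Suc by simp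
qed simp

lemma (in cocoercive_gradient) prox_rate_silver: "prox_rate (silver k) (silver_ratio ^ k)"
proof (induction k)
  case 0
  then show ?case using prox_rate_Nil by simp
next
  case (Suc k)
  have "prox_rate (silver k @ [1 + silver_ratio ^ k * (1 / silver_ratio)] @ silver k)
      (silver_ratio ^ Suc k)"
  proof (rule prox_rate_join)
    have "silver_ratio * (1 - 1 / silver_ratio) = 1 + 1 / silver_ratio"
      using silver_ratio_gt_1 inverse_silver_ratio by (simp add: algebra_simps)
    then show "silver_ratio ^ Suc k * (1 - 1 / silver_ratio) = silver_ratio ^ k * (1 + 1 / silver_ratio)"
      by (metis mult.assoc power_Suc2)
    show "prox_rate (silver k) (1 / silver_ratio * silver_ratio ^ Suc k)"
      using Suc silver_ratio_gt_1 by simp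
  qed (use Suc silver_ratio_gt_1 in auto)
  then show ?case unfolding silver_Suc .
qed

section \<open>The right-sided schedule\<close>

lemma r_right_pos: "r_right k > 0"
proof -
  have "sum_list (h_right k) \<ge> 0"
    using h_right_gt_1[of _ k] by (force intro: sum_list_nonneg)
  then show ?thesis by (simp add: r_right_def)
qed

text \<open>
  Write the middle step as \<open>1 + a t\<close> with \<open>a = \<rho>\<^sup>k\<close>, and let \<open>r = r\<^sub>k\<close>, \<open>r' = r\<^sub>k\<^sub>+\<^sub>1\<close>. The two
  expressions for \<open>r'\<close>, by the sum and by the product of the schedule, are \<open>r' = 2 a (1 + t) + r\<close>
  and \<open>r' = r / t\<^sup>2\<close>. Subtracting \<open>r = r' t\<^sup>2\<close> from the first and dividing by \<open>1 + t\<close> gives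
  \<open>r' (1 - t) = 2 a\<close>; positivity of \<open>r'\<close> then forces \<open>t < 1\<close>.
\<close>

lemma h_right_Suc:
  obtains t where "0 < t" "t < 1"
    and "h_right (Suc k) = silver k @ [1 + silver_ratio ^ k * t] @ h_right k"
    and "r_right (Suc k) * (1 - t) = 2 * silver_ratio ^ k"
    and "r_right k = r_right (Suc k) * t\<^sup>2"
proof -
  define a where "a = silver_ratio ^ k"
  have a: "a > 0" using silver_ratio_gt_1 by (simp add: a_def)
  obtain \<mu> where \<mu>: "h_right (Suc k) = silver k @ [\<mu>] @ h_right k"
  proof (cases k)
    case 0
    then show thesis using that[of "3 / 2"] by simp
  qed auto
  define t where "t = (\<mu> - 1) / a"
  have "\<mu> > 1" using h_right_gt_1[of \<mu> "Suc k"] \<mu> by simp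
  then have t: "0 < t" using a by (simp add: t_def)
  have \<mu>_eq: "\<mu> = 1 + a * t" using a by (simp add: t_def)
  have sum: "r_right (Suc k) = 2 * a * (1 + t) + r_right k"
    unfolding r_right_def \<mu> by (simp add: sum_silver \<mu>_eq algebra_simps flip: a_def)
  have "r_right (Suc k) = a\<^sup>2 * (a * t) powi (-2) * r_right k"
    unfolding r_right_eq_prod \<mu> by (simp add: prod_silver \<mu>_eq flip: a_def)
  also have "\<dots> = r_right k / t\<^sup>2"
    using a t by (simp add: power_int_minus field_simps)
  finally have prod: "r_right k = r_right (Suc k) * t\<^sup>2"
    using t by simp
  have "(1 + t) * (r_right (Suc k) * (1 - t)) = (1 + t) * (2 * a)"
    using sum prod by (simp add: algebra_simps power2_eq_square)
  then have r: "r_right (Suc k) * (1 - t) = 2 * a"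
    using t by simp
  then have "0 < r_right (Suc k) * (1 - t)" using a by simp
  then have "t < 1" using r_right_pos[of "Suc k"] by (simp add: zero_less_mult_iff)
  then show thesis using that t \<mu> r prod by (simp add: \<mu>_eq a_def)
qed

lemma (in cocoercive_gradient) value_rate_h_right: "value_rate (h_right k) (r_right k)"
proof (induction k)
  case 0
  then show ?case using value_rate_Nil by (simp add: r_right_def)
next
  case (Suc k)
  obtain t where t: "0 < t" "t < 1"
    and h: "h_right (Suc k) = silver k @ [1 + silver_ratio ^ k * t] @ h_right k"
    and r: "r_right (Suc k) * (1 - t) = 2 * silver_ratio ^ k"
    and r': "r_right k = r_right (Suc k) * t\<^sup>2"
    by (rule h_right_Suc)
  show ?case unfolding h
    by (rule value_rate_join[OF prox_rate_silver Suc[unfolded r'] _ t r])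
      (use silver_ratio_gt_1 in simp)
qed

section \<open>Asymptotics of the rate\<close>

text \<open>
  The recursion has the fixed point \<open>c\<close>. Comparing it at \<open>t\<close> and at \<open>c\<close> gives the identity
  \<open>(c - t') (t' + c (1 - t')) = t'\<^sup>2 (c - t)\<close>, so the iterates stay on one side of \<open>c\<close> and the distance
  shrinks by a factor of at most \<open>t' \<le> c\<close>.
\<close>

lemma step_recursion_contracts:
  fixes c t t' \<rho> :: real
  assumes c: "0 < c" "c < 1" and \<rho>: "\<rho> * c\<^sup>2 = 1" and t': "0 < t'" "t' < 1"
    and rec: "\<rho> * t'\<^sup>2 * (1 - t) = 1 - t'" and t: "t \<le> c"
  shows "t' \<le> c" and "c - t' \<le> c * (c - t)"
proof -
  have "t'\<^sup>2 * (1 - t) = c\<^sup>2 * (\<rho> * t'\<^sup>2 * (1 - t))"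
    using \<rho> by (metis mult.assoc mult.commute mult.left_neutral)
  then have "t'\<^sup>2 * (1 - t) = c\<^sup>2 * (1 - t')"
    by (simp add: rec)
  then have key: "(c - t') * (t' + c * (1 - t')) = t'\<^sup>2 * (c - t)"
    by (simp add: algebra_simps power2_eq_square)
  have pos: "0 < t' + c * (1 - t')"
    using c t' by (intro add_pos_pos) auto
  have "0 \<le> (c - t') * (t' + c * (1 - t'))"
    unfolding key using t by simp
  then show le: "t' \<le> c"
    using pos by (simp add: zero_le_mult_iff)
  have "(c - t') * t' \<le> (c - t') * (t' + c * (1 - t'))"
    using le c t' by (intro mult_left_mono) auto
  then have "t' * (c - t') \<le> t' * (t' * (c - t))"
    unfolding key by (simp add: power2_eq_square mult_ac)
  then have "c - t' \<le> t' * (c - t)"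
    using t' by simp
  also have "\<dots> \<le> c * (c - t)"
    using le t by (intro mult_right_mono) auto
  finally show "c - t' \<le> c * (c - t)" .
qed

lemma inverse_sqrt_silver_ratio:
  defines "c \<equiv> silver_ratio powr (-1/2)"
  shows "0 < c" "c < 1" "silver_ratio * c\<^sup>2 = 1"
proof -
  show "0 < c" "c < 1"
    using silver_ratio_gt_1 by (auto simp: c_def intro: powr_less_one)
  have "c\<^sup>2 = silver_ratio powr (-1)"
    using silver_ratio_gt_1 by (simp add: c_def powr_power)
  then show "silver_ratio * c\<^sup>2 = 1"
    using silver_ratio_gt_1 by (simp add: powr_minus)
qed

lemma r_right_over_silver_power:
  defines "c \<equiv> silver_ratio powr (-1/2)"
  shows "(\<lambda>k. r_right (Suc k) / silver_ratio ^ k) \<longlonglongrightarrow> 2 / (1 - c)"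
proof -
  note c = inverse_sqrt_silver_ratio(1,2)[folded c_def]
    and \<rho>c = inverse_sqrt_silver_ratio(3)[folded c_def]
  have "\<forall>k. \<exists>t. 0 < t \<and> t < 1 \<and> r_right (Suc k) * (1 - t) = 2 * silver_ratio ^ k
      \<and> r_right k = r_right (Suc k) * t\<^sup>2"
    by (meson h_right_Suc)
  then obtain t where t: "\<And>k. 0 < t k" "\<And>k. t k < 1"
    and r: "\<And>k. r_right (Suc k) * (1 - t k) = 2 * silver_ratio ^ k"
    and r': "\<And>k. r_right k = r_right (Suc k) * (t k)\<^sup>2"
    by metis
  have "r_right 0 = 1" by (simp add: r_right_def)
  have "2 * (t 0)\<^sup>2 = (r_right (Suc 0) * (1 - t 0)) * (t 0)\<^sup>2"
    unfolding r by simp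
  also have "\<dots> = (r_right (Suc 0) * (t 0)\<^sup>2) * (1 - t 0)"
    by (simp only: mult_ac)
  finally have "2 * (t 0)\<^sup>2 = 1 - t 0"
    unfolding r'[of 0, symmetric] \<open>r_right 0 = 1\<close> by simp
  then have "(2 * t 0 - 1) * (t 0 + 1) = 0"
    by (simp add: algebra_simps power2_eq_square)
  then have t0: "t 0 = 1 / 2"
    using t(1)[of 0] by auto
  (* The first parameter 1/2 lies below the fixed point, because (1/2)^2 < 1/rho. *)
  have "silver_ratio < 4"
    using sqrt2_less_2 by (simp add: silver_ratio_def)
  then have "silver_ratio * c\<^sup>2 < 4 * c\<^sup>2"
    using c by simp
  then have "1 / 4 < c\<^sup>2"
    unfolding \<rho>c by linarith
  then have "(1 / 2)\<^sup>2 \<le> c\<^sup>2"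
    unfolding power_divide by simp
  then have "t 0 \<le> c"
    unfolding t0 by (rule power2_le_imp_le) (use c(1) in simp)
  have rec: "silver_ratio * (t (Suc k))\<^sup>2 * (1 - t k) = 1 - t (Suc k)" for k
  proof -
    define u where "u = t (Suc k)"
    have "r_right (Suc (Suc k)) * (silver_ratio * u\<^sup>2 * (1 - t k))
        = silver_ratio * (r_right (Suc k) * (1 - t k))"
      unfolding u_def r'[of "Suc k"] by (simp add: mult_ac)
    also have "\<dots> = r_right (Suc (Suc k)) * (1 - u)"
      unfolding r u_def by simp
    finally show ?thesis
      using r_right_pos[of "Suc (Suc k)"] by (simp add: u_def)
  qed
  have bounds: "t k \<le> c \<and> c - t k \<le> c ^ k * (c - t 0)" for k
  proof (induction k)
    case (Suc k)
    note step = step_recursion_contracts[OF c \<rho>c t(1) t(2) rec, of k]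
    have "c * (c - t k) \<le> c * (c ^ k * (c - t 0))"
      using Suc c by (intro mult_left_mono) auto
    then show ?case using step Suc by (simp add: mult_ac)
  qed (use \<open>t 0 \<le> c\<close> in simp)
  have "t \<longlonglongrightarrow> c"
  proof (rule tendsto_sandwich)
    have "(\<lambda>k. c - c ^ k * (c - t 0)) \<longlonglongrightarrow> c - 0 * (c - t 0)"
      using c by (intro tendsto_intros) auto
    then show "(\<lambda>k. c - c ^ k * (c - t 0)) \<longlonglongrightarrow> c"
      by simp
    show "\<forall>\<^sub>F k in sequentially. c - c ^ k * (c - t 0) \<le> t k"
      using bounds by (intro always_eventually) (auto simp: algebra_simps)
    show "\<forall>\<^sub>F k in sequentially. t k \<le> c"
      using bounds by (intro always_eventually) auto
  qed simp
  then have "(\<lambda>k. 2 / (1 - t k)) \<longlonglongrightarrow> 2 / (1 - c)"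
    using c by (intro tendsto_intros) auto
  moreover have "2 / (1 - t k) = r_right (Suc k) / silver_ratio ^ k" for k
    using r[of k] t(2)[of k] silver_ratio_gt_1 by (simp add: field_simps)
  ultimately show ?thesis by simp
qed

text \<open>Since \<open>2 powr log 2 \<rho> = \<rho>\<close>, the quotient is \<open>(1 - 2\<^sup>-\<^sup>k) powr (- log 2 \<rho>)\<close> for \<open>k > 0\<close>.\<close>

lemma silver_power_over_length_powr:
  "(\<lambda>k. silver_ratio ^ k / real (2 ^ k - 1) powr log 2 silver_ratio) \<longlonglongrightarrow> 1"
proof -
  let ?l = "log 2 silver_ratio"
  have "(\<lambda>k. (1 / 2) ^ k :: real) \<longlonglongrightarrow> 0"
    by (intro LIMSEQ_power_zero) auto
  then have "(\<lambda>k. 1 / (1 - (1 / 2) ^ k) powr ?l) \<longlonglongrightarrow> 1 / (1 - 0) powr ?l"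
    by (intro tendsto_intros) auto
  moreover have "1 / (1 - (1 / 2) ^ k) powr ?l
      = silver_ratio ^ k / real (2 ^ k - 1) powr ?l" for k :: nat
  proof -
    have "real (2 ^ k - 1) = 2 ^ k * (1 - (1 / 2) ^ k)"
      by (simp add: of_nat_diff algebra_simps flip: power_mult_distrib)
    also have "\<dots> powr ?l = (2 ^ k) powr ?l * (1 - (1 / 2) ^ k) powr ?l"
      by (intro powr_mult)
    also have "(2 ^ k) powr ?l = (2 powr ?l) ^ k"
      by (simp add: powr_power powr_powr mult.commute flip: powr_realpow)
    also have "2 powr ?l = silver_ratio"
      using silver_ratio_gt_1 by simp
    finally show ?thesis using silver_ratio_gt_1 by simp
  qed
  ultimately show ?thesis by simp
qed

lemma r_right_asymptotics:
  "(\<lambda>k. r_right k / real (2 ^ k - 1) powr log 2 silver_ratio)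
    \<longlonglongrightarrow> (silver_ratio - 1) * (1 + silver_ratio powr (-1/2))"
proof -
  define c where "c = silver_ratio powr (-1/2)"
  note c = inverse_sqrt_silver_ratio(2)[folded c_def]
    and \<rho>c = inverse_sqrt_silver_ratio(3)[folded c_def]
  have "(\<lambda>k. (r_right (Suc k) / silver_ratio ^ k)
        * (silver_ratio ^ Suc k / real (2 ^ Suc k - 1) powr log 2 silver_ratio) / silver_ratio)
      \<longlonglongrightarrow> 2 / (1 - c) * 1 / silver_ratio"
    unfolding c_def using silver_ratio_gt_1
    by (intro tendsto_intros r_right_over_silver_power
        LIMSEQ_Suc[OF silver_power_over_length_powr]) auto
  also have "(\<lambda>k. (r_right (Suc k) / silver_ratio ^ k)
        * (silver_ratio ^ Suc k / real (2 ^ Suc k - 1) powr log 2 silver_ratio) / silver_ratio)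
      = (\<lambda>k. r_right (Suc k) / real (2 ^ Suc k - 1) powr log 2 silver_ratio)"
    using silver_ratio_gt_1 by (intro ext) (simp add: field_simps)
  (* (rho - 1)^2 = 2, and rho c^2 = 1 turns (1 + c) (1 - c) rho into rho - 1. *)
  also have "2 / (1 - c) * 1 / silver_ratio = (silver_ratio - 1) * (1 + c)"
  proof -
    have "(silver_ratio - 1) * (1 + c) * (silver_ratio * (1 - c))
        = (silver_ratio - 1) * (silver_ratio - silver_ratio * c\<^sup>2)"
      by (simp add: algebra_simps power2_eq_square)
    also have "\<dots> = 2"
      unfolding \<rho>c using silver_ratio_square by (simp add: algebra_simps power2_eq_square)
    finally show ?thesis
      using c silver_ratio_gt_1 by (simp add: field_simps)
  qed
  finally show ?thesis
    unfolding c_def by (rule LIMSEQ_imp_Suc)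
qed

theorem theorem2:
  fixes L :: real and f :: "real ^ 'n \<Rightarrow> real" and x_star :: "real ^ 'n"
    and k N :: nat and x :: "nat \<Rightarrow> real ^ 'n"
  assumes "L > 0"
    and "convex_on UNIV f"
    and "L_smooth L f"
    and "\<forall>y. f x_star \<le> f y"
    and "N = 2 ^ k - 1"
    and "\<forall>i<N. x (Suc i) = x i - (h_right k ! i / L) *\<^sub>R grad f (x i)"
  shows "f (x N) - f x_star \<le> (L / 2 * (norm (x 0 - x_star))\<^sup>2) / r_right k
    \<and> (\<lambda>j. r_right j / real (2 ^ j - 1) powr log 2 silver_ratio)
        \<longlonglongrightarrow> (silver_ratio - 1) * (1 + silver_ratio powr (-1/2))"
proof
  have grad: "GDERIV f y :> grad f y" for y
    using assms(3) by (auto simp: L_smooth_def intro: differentiable_GDERIV_grad)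
  have lip: "L-lipschitz_on UNIV (grad f)"
    using assms(3) by (simp add: L_smooth_def)
  note cocoercive = convex_smooth_cocoercive[OF assms(1,2) lip grad]
  define F where "F y = f y / L" for y
  define G where "G y = (1 / L) *\<^sub>R grad f y" for y
  interpret cocoercive_gradient F G
  proof
    fix y z
    have "(norm (G y - G z))\<^sup>2 = (norm (grad f y - grad f z))\<^sup>2 / L\<^sup>2"
      unfolding G_def scaleR_diff_right[symmetric] by (simp add: power_divide)
    moreover have "(f y + grad f y \<bullet> (z - y) + (norm (grad f y - grad f z))\<^sup>2 / (2 * L)) / L \<le> f z / L"
      using cocoercive[of y z] assms(1) by (intro divide_right_mono) auto
    ultimately show "F y + G y \<bullet> (z - y) + (norm (G y - G z))\<^sup>2 / 2 \<le> F z"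
      by (simp add: F_def G_def add_divide_distrib power2_eq_square mult_ac)
  qed
  have "GDERIV f x_star :> 0"
  proof -
    have "(\<lambda>h. h \<bullet> grad f x_star) = (\<lambda>h. 0)"
      using grad[of x_star] assms(4) unfolding gderiv_def
      by (intro has_derivative_local_min[of f _ x_star]) auto
    with grad[of x_star] show ?thesis by (simp add: gderiv_def)
  qed
  then have "G x_star = 0" by (simp add: G_def grad_eqI)
  then have "in_epigraph x_star (F x_star)"
    using assms(1,4) by (intro in_epigraph_minimizer) (auto simp: F_def divide_right_mono)
  moreover have "descend (h_right k) (x 0) = x N"
    unfolding assms(5) length_h_right[symmetric]
    by (rule descend_eq_iterate) (use assms(5,6) in \<open>simp add: G_def length_h_right\<close>)
  ultimately have "2 * r_right k * (F (x N) - F x_star) \<le> (norm (x 0 - x_star))\<^sup>2"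
    using value_rate_h_right[of k] by (metis value_rate_def)
  moreover have "F (x N) - F x_star = (f (x N) - f x_star) / L"
    by (simp add: F_def diff_divide_distrib)
  ultimately show "f (x N) - f x_star \<le> (L / 2 * (norm (x 0 - x_star))\<^sup>2) / r_right k"
    using assms(1) r_right_pos[of k] by (simp add: field_simps)
qed (rule r_right_asymptotics)

end
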